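(* Let $G$ be a signed graph on $n\ge 3$ vertices. Then the number of Laplacian inertias achieved by $G$ is at most $\binom{n+1}{2}-3$.
   Context: A signed graph is a simple graph $G=(V(G),E(G))$ with vertex set $V(G)=\{1,\dots,n\}$ (possibly disconnected) together with an assignment of a sign $+$ or $-$ to each edge. A consistent weighting $\gamma$ of $G$ assigns to each edge $ij$ a nonzero real number $\gamma_{ij}$ whose sign is the sign of the edge; $\Gamma=(G,\gamma)$ is then a weighted signed graph. Its Laplacian is $L(\Gamma)=A-D$, where $A=[a_{ij}]$ is the symmetric $n\times n$ matrix with $a_{ij}=\gamma_{ij}$ if $ij\in E(G)$ and $a_{ij}=0$ otherwise, and $D=\mathrm{diag}(d_1,\dots,d_n)$ with $d_i$ the sum of the weights of the edges incident to vertex $i$. The Laplacian inertia of $\Gamma$ is $IL(\Gamma)=(n_+,n_-,n_0)$, the numbers of positive, negative and zero eigenvalues of $L(\Gamma)$, counted with multiplicity. $G$ achieves a triple $(n_+,n_-,n_0)$ if $IL(G,\gamma)=(n_+,n_-,n_0)$ for some consistent weighting $\gamma$ of $G$; the number of Laplacian inertias achieved by $G$ is the number of distinct such triples. *)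

theory Defs
  imports "Jordan_Normal_Form.Char_Poly"
begin

(* A signed graph on n vertices is a set E of edges together with a sign function s.
   The vertices are 0, ..., n - 1 rather than 1, ..., n, to match the indexing of matrices;
   edges are two-element sets of vertices. The values of s, and of the weightings below,
   outside E are irrelevant. *)

datatype sign = Pos | Neg

definition signed_graph :: "nat \<Rightarrow> nat set set \<Rightarrow> (nat set \<Rightarrow> sign) \<Rightarrow> bool" where
  "signed_graph n E s \<longleftrightarrow> (\<forall>e\<in>E. e \<subseteq> {..<n} \<and> card e = 2)"

definition consistent_weighting ::
    "nat set set \<Rightarrow> (nat set \<Rightarrow> sign) \<Rightarrow> (nat set \<Rightarrow> real) \<Rightarrow> bool" where
  "consistent_weighting E s \<gamma> \<longleftrightarrow>
     (\<forall>e\<in>E. case s e of Pos \<Rightarrow> \<gamma> e > 0 | Neg \<Rightarrow> \<gamma> e < 0)"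

definition adjacency_matrix :: "nat \<Rightarrow> nat set set \<Rightarrow> (nat set \<Rightarrow> real) \<Rightarrow> real mat" where
  "adjacency_matrix n E \<gamma> = mat n n (\<lambda>(i, j). if {i, j} \<in> E then \<gamma> {i, j} else 0)"

definition degree_matrix :: "nat \<Rightarrow> nat set set \<Rightarrow> (nat set \<Rightarrow> real) \<Rightarrow> real mat" where
  "degree_matrix n E \<gamma> = mat_diag n (\<lambda>i. \<Sum>e\<in>{e\<in>E. i \<in> e}. \<gamma> e)"

(* The sign convention is A - D, so positive weights contribute nonpositive eigenvalues. *)

definition laplacian :: "nat \<Rightarrow> nat set set \<Rightarrow> (nat set \<Rightarrow> real) \<Rightarrow> real mat" where
  "laplacian n E \<gamma> = adjacency_matrix n E \<gamma> - degree_matrix n E \<gamma>"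

(* Eigenvalues with multiplicity, as the multiset of real roots of the characteristic
   polynomial. It is applied to symmetric matrices only, which have no other eigenvalues. *)

definition eigenvalue_mset :: "real mat \<Rightarrow> real multiset" where
  "eigenvalue_mset M = proots (char_poly M)"

definition inertia :: "real mat \<Rightarrow> nat \<times> nat \<times> nat" where
  "inertia M =
     (size {#x \<in># eigenvalue_mset M. x > 0#},
      size {#x \<in># eigenvalue_mset M. x < 0#},
      size {#x \<in># eigenvalue_mset M. x = 0#})"

definition achieved_inertias ::
    "nat \<Rightarrow> nat set set \<Rightarrow> (nat set \<Rightarrow> sign) \<Rightarrow> (nat \<times> nat \<times> nat) set" where
  "achieved_inertias n E s = {inertia (laplacian n E \<gamma>) |\<gamma>. consistent_weighting E s \<gamma>}"

end

(* Since the all-ones vector lies in the kernel, the inertias (a, b, c) correspond to points (a, b) of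
   the triangle a + b < n, which has binomial(n+1, 2) points; three of them have to be excluded.
   For a proper nonempty vertex set S, the quadratic form of L at the indicator vector of S is minus
   the sum of the weights of the edges leaving S.
   - If some S has no leaving edge, the kernel has dimension at least 2, so a + b < n - 1.
   - If all edges leaving some S are negative, then a >= 1; if all are positive, then b >= 1.
   - If every S is left by edges of both signs, then L has rank at least 2: if L = r q q^T, then q
     sums to zero and the edges leaving {i. q i > 0} all have the same sign.
   Each alternative excludes at least three points. *)

theory Submission
  imports Defs
begin

section \<open>Spectral theorem for real symmetric matrices\<close>

text \<open>The complexified matrix has an eigenvalue \<open>l\<close>, and symmetry forces
  \<open>l\<close> to be real. It is then a root of the real characteristic polynomial, which yields
  a real eigenvector.\<close>

lemma symmetric_mat_has_eigenvector:
  fixes A :: "real mat"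
  assumes A: "A \<in> carrier_mat n n" and sym: "transpose_mat A = A" and n: "n > 0"
  obtains v e where "v \<in> carrier_vec n" "v \<noteq> 0\<^sub>v n" "A *\<^sub>v v = e \<cdot>\<^sub>v v"
proof -
  let ?C = "map_mat complex_of_real A"
  have C: "?C \<in> carrier_mat n n" using A by auto
  have "degree (char_poly ?C) = n" using degree_monic_char_poly[OF C] by auto
  then obtain l where "poly (char_poly ?C) l = 0"
    using n fundamental_theorem_of_algebra[of "char_poly ?C"] by (metis constant_degree neq0_conv)
  then obtain z where z: "eigenvector ?C z l"
    using eigenvalue_root_char_poly[OF C] unfolding eigenvalue_def by auto
  hence zc: "z \<in> carrier_vec n" and z0: "z \<noteq> 0\<^sub>v n" and ev: "?C *\<^sub>v z = l \<cdot>\<^sub>v z"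
    using C unfolding eigenvector_def by auto
  have row: "(\<Sum>j<n. of_real (A $$ (i,j)) * z $ j) = l * z $ i" if "i < n" for i
    using arg_cong[OF ev, of "\<lambda>v. v $ i"] that A zc
    by (simp add: scalar_prod_def atLeast0LessThan)
  \<comment> \<open>\<open>?q\<close> is the squared norm of \<open>z\<close> and \<open>?s\<close>
    the Hermitian form of \<open>A\<close> at \<open>z\<close>. The form is its own conjugate and
    equals \<open>l * ?q\<close>, so \<open>l\<close> is real because \<open>?q\<close> is real and
    nonzero.\<close>
  let ?q = "\<Sum>i<n. cnj (z $ i) * z $ i"
  let ?s = "\<Sum>i<n. \<Sum>j<n. cnj (z $ i) * of_real (A $$ (i,j)) * z $ j"
  have s1: "?s = l * ?q"
    unfolding sum_distrib_left
    by (rule sum.cong) (auto simp: row mult.assoc sum_distrib_left[symmetric])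
  have As: "A $$ (i,j) = A $$ (j,i)" if "i < n" "j < n" for i j
    using arg_cong[OF sym, of "\<lambda>M. M $$ (i,j)"] that A by simp
  have "cnj ?s = (\<Sum>i<n. \<Sum>j<n. cnj (z $ j) * of_real (A $$ (i,j)) * z $ i)"
    by (simp add: ac_simps)
  also have "\<dots> = (\<Sum>j<n. \<Sum>i<n. cnj (z $ j) * of_real (A $$ (i,j)) * z $ i)"
    by (rule sum.swap)
  also have "\<dots> = ?s"
    by (intro sum.cong refl) (auto simp: As)
  finally have s2: "cnj ?s = ?s" .
  have qr: "?q = of_real (\<Sum>i<n. (cmod (z $ i))\<^sup>2)"
    by (simp add: complex_norm_square mult.commute del: of_real_power)
  have "\<exists>i<n. z $ i \<noteq> 0" using z0 zc by (metis carrier_vecD eq_vecI index_zero_vec)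
  then obtain i where i: "i < n" "z $ i \<noteq> 0" by auto
  have "(\<Sum>i<n. (cmod (z $ i))\<^sup>2) > 0"
    by (rule sum_pos2[of _ i]) (use i in auto)
  hence q0: "?q \<noteq> 0" unfolding qr by (metis less_irrefl of_real_eq_0_iff)
  have "cnj ?q = ?q" unfolding qr by simp
  moreover have "cnj l * cnj ?q = l * ?q" using s2 unfolding s1 complex_cnj_mult .
  ultimately have "cnj l = l" using q0 by (metis (no_types, lifting) mult_right_cancel)
  then obtain e where e: "l = of_real e" by (metis Reals_cases complex_is_Real_iff Reals_cnj_iff)
  have "poly (map_poly of_real (char_poly A)) (complex_of_real e) = 0"
    using \<open>poly (char_poly ?C) l = 0\<close> unfolding e of_real_hom.char_poly_hom[OF A] .
  hence "poly (char_poly A) e = 0" by simp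
  then obtain v where "eigenvector A v e"
    using eigenvalue_root_char_poly[OF A] unfolding eigenvalue_def by auto
  thus ?thesis using that A unfolding eigenvector_def by auto
qed

text \<open>The reflection in the hyperplane orthogonal to \<open>w = u - unit_vec (Suc n) 0\<close>
  interchanges the two unit vectors. It gives an orthogonal matrix with first column
  \<open>u\<close> without completing \<open>u\<close> to an orthonormal basis.\<close>

lemma householder_reflection:
  fixes u :: "real vec"
  assumes u: "u \<in> carrier_vec (Suc n)" and norm: "u \<bullet> u = 1"
  obtains H where "H \<in> carrier_mat (Suc n) (Suc n)" "transpose_mat H = H"
    "H * H = 1\<^sub>m (Suc n)" "H *\<^sub>v unit_vec (Suc n) 0 = u"
proof -
  define w where "w i = u $ i - (if i = 0 then 1 else 0)" for i
  define q where "q = (\<Sum>i<Suc n. w i * w i)"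
  \<comment> \<open>If \<open>u\<close> is already the first unit vector, then \<open>q = 0\<close>, so \<open>c = 0\<close> and \<open>H\<close> is the identity.\<close>
  define c where "c = 2 / q"
  define H where "H = mat (Suc n) (Suc n) (\<lambda>(i,j). (if i = j then 1 else 0) - c * w i * w j)"
  have uu: "(\<Sum>i<Suc n. u $ i * u $ i) = 1"
    using norm u by (simp add: scalar_prod_def atLeast0LessThan)
  \<comment> \<open>Both vectors have norm 1, so the squared norm of their difference is 2 - 2
    \<open>u $ 0\<close>.\<close>
  have "q = (\<Sum>i<Suc n. u $ i * u $ i - (if i = 0 then 2 * u $ 0 - 1 else 0))"
    unfolding q_def w_def by (rule sum.cong) (auto simp: algebra_simps)
  hence q: "q = - 2 * w 0" unfolding sum_subtractf uu by (simp add: w_def)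
  \<comment> \<open>This is what makes the quadratic terms cancel in \<open>H * H\<close>; for
    \<open>q = 0\<close> both sides vanish.\<close>
  have cq: "c * c * q = 2 * c" unfolding c_def by auto
  have w0: "w i = 0" if "q = 0" "i < Suc n" for i
    using sum_nonneg_eq_0_iff[of "{..<Suc n}" "\<lambda>i. w i * w i"] that unfolding q_def by auto
  show ?thesis
  proof (rule that)
    show H: "H \<in> carrier_mat (Suc n) (Suc n)" by (simp add: H_def)
    show "transpose_mat H = H" by (rule eq_matI) (auto simp: H_def)
    show "H * H = 1\<^sub>m (Suc n)"
    proof (rule eq_matI)
      fix i j assume "i < dim_row (1\<^sub>m (Suc n))" "j < dim_col (1\<^sub>m (Suc n))"
      hence ij: "i < Suc n" "j < Suc n" by auto
      have "(H * H) $$ (i,j) = (\<Sum>k<Suc n. ((if i = k then 1 else 0) - c * w i * w k)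
          * ((if k = j then 1 else 0) - c * w k * w j))"
        using ij by (simp add: H_def scalar_prod_def atLeast0LessThan del: sum.lessThan_Suc)
      also have "\<dots> = (\<Sum>k<Suc n. (if i = k then (if k = j then 1 else 0) - c * w k * w j else 0)
          - (if k = j then c * w i * w k else 0) + c * c * w i * w j * (w k * w k))"
        by (rule sum.cong) (auto simp: algebra_simps)
      also have "\<dots> = (if i = j then 1 else 0) - 2 * c * w i * w j + c * c * q * w i * w j"
        using ij unfolding sum.distrib sum_subtractf sum_distrib_left[symmetric] q_def[symmetric]
        by (simp add: sum.delta sum.delta' algebra_simps del: sum.lessThan_Suc)
      finally show "(H * H) $$ (i,j) = 1\<^sub>m (Suc n) $$ (i,j)" using ij unfolding cq by simp
    qed (use H in auto)
    show "H *\<^sub>v unit_vec (Suc n) 0 = u"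
    proof (rule eq_vecI)
      fix i assume "i < dim_vec u"
      hence i: "i < Suc n" using u by auto
      have "(H *\<^sub>v unit_vec (Suc n) 0) $ i = (if i = 0 then 1 else 0) - c * w i * w 0"
        using i by (simp add: H_def)
      also have "\<dots> = u $ i"
      proof (cases "q = 0")
        case True
        thus ?thesis using w0[OF True i] by (simp add: w_def)
      next
        case False
        hence "c * w 0 = - 1" unfolding c_def q by simp
        hence "c * w i * w 0 = - w i" by (metis mult.assoc mult.commute mult_minus1)
        thus ?thesis by (simp add: w_def)
      qed
      finally show "(H *\<^sub>v unit_vec (Suc n) 0) $ i = u $ i" .
    qed (use H u in auto)
  qed
qed

text \<open>Deflation: conjugating by a reflection that takes the first unit vector to a unit
  eigenvector splits off a 1 by 1 block, and the induction hypothesis diagonalizes the remaining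
  symmetric block.\<close>

lemma real_symmetric_diagonalization:
  fixes A :: "real mat"
  assumes "A \<in> carrier_mat n n" and "transpose_mat A = A"
  shows "\<exists>P d. P \<in> carrier_mat n n \<and> P * transpose_mat P = 1\<^sub>m n \<and> transpose_mat P * P = 1\<^sub>m n \<and>
    A = P * mat_diag n d * transpose_mat P"
  using assms
proof (induction n arbitrary: A)
  case 0
  show ?case
    by (rule exI[of _ "1\<^sub>m 0"]) (use 0 in \<open>auto intro!: eq_matI\<close>)
next
  case (Suc n)
  let ?m = "Suc n"
  note A = Suc.prems(1) and sym = Suc.prems(2)
  obtain v e where v: "v \<in> carrier_vec ?m" "v \<noteq> 0\<^sub>v ?m" "A *\<^sub>v v = e \<cdot>\<^sub>v v"
    using symmetric_mat_has_eigenvector[OF A sym zero_less_Suc] .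
  have vv: "v \<bullet> v > 0" using conjugate_square_greater_0_vec[OF v(1)] v(2) by simp
  define u where "u = (1 / sqrt (v \<bullet> v)) \<cdot>\<^sub>v v"
  have u: "u \<in> carrier_vec ?m" using v by (simp add: u_def)
  have "u \<bullet> u = 1" using v(1) vv by (simp add: u_def)
  from householder_reflection[OF u this] obtain H where
    H: "H \<in> carrier_mat ?m ?m" and Hs: "transpose_mat H = H" and HH: "H * H = 1\<^sub>m ?m"
    and Hu: "H *\<^sub>v unit_vec ?m 0 = u" .
  have Au: "A *\<^sub>v u = e \<cdot>\<^sub>v u"
    unfolding u_def using v A by (simp add: mult_mat_vec smult_smult_assoc mult.commute)
  define B where "B = H * A * H"
  have B: "B \<in> carrier_mat ?m ?m" using H A by (simp add: B_def)
  have Bs: "transpose_mat B = B"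
    unfolding B_def using H A sym Hs
    by (simp add: transpose_mult[of _ ?m ?m _ ?m] assoc_mult_mat[of _ ?m ?m _ ?m _ ?m])
  \<comment> \<open>\<open>H\<close> interchanges the first unit vector and \<open>u\<close>, so the
    eigenvector \<open>u\<close> of \<open>A\<close> becomes the eigenvector
    \<open>unit_vec ?m 0\<close> of \<open>B\<close>. This fixes the first column of
    \<open>B\<close>, and by symmetry its first row.\<close>
  have "B *\<^sub>v unit_vec ?m 0 = H *\<^sub>v (A *\<^sub>v (H *\<^sub>v unit_vec ?m 0))"
    unfolding B_def using H A by (simp add: assoc_mult_mat_vec[of _ ?m ?m _ ?m])
  also have "\<dots> = e \<cdot>\<^sub>v (H *\<^sub>v (H *\<^sub>v unit_vec ?m 0))"
    unfolding Hu Au using H u by (simp add: mult_mat_vec)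
  also have "H *\<^sub>v (H *\<^sub>v unit_vec ?m 0) = unit_vec ?m 0"
    using H HH by (simp add: assoc_mult_mat_vec[of _ ?m ?m _ ?m, symmetric])
  finally have Be: "B *\<^sub>v unit_vec ?m 0 = e \<cdot>\<^sub>v unit_vec ?m 0" .
  have col0: "B $$ (i,0) = (if i = 0 then e else 0)" if "i < ?m" for i
    using arg_cong[OF Be, of "\<lambda>v. v $ i"] that B by simp
  have row0: "B $$ (0,i) = (if i = 0 then e else 0)" if "i < ?m" for i
    using col0[OF that] arg_cong[OF Bs, of "\<lambda>M. M $$ (i,0)"] that B by simp
  define B' where "B' = mat n n (\<lambda>(i,j). B $$ (Suc i, Suc j))"
  have B': "B' \<in> carrier_mat n n" by (simp add: B'_def)
  have "B $$ (i,j) = B $$ (j,i)" if "i < ?m" "j < ?m" for i j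
    using arg_cong[OF Bs, of "\<lambda>M. M $$ (i,j)"] that B by simp
  hence "transpose_mat B' = B'" by (intro eq_matI) (auto simp: B'_def)
  from Suc.IH[OF B' this] obtain Q d where
    Q: "Q \<in> carrier_mat n n" and QQ: "Q * transpose_mat Q = 1\<^sub>m n" "transpose_mat Q * Q = 1\<^sub>m n"
    and B'Q: "B' = Q * mat_diag n d * transpose_mat Q" by auto
  \<comment> \<open>The block diagonal matrix with blocks \<open>a\<close> and \<open>M\<close>;
    such matrices multiply blockwise.\<close>
  let ?blk = "\<lambda>a M. four_block_mat (mat 1 1 (\<lambda>_. a)) (0\<^sub>m 1 n) (0\<^sub>m n 1) M"
  have blk_mult: "?blk a M * ?blk b N = ?blk (a * b) (M * N)"
    if "M \<in> carrier_mat n n" "N \<in> carrier_mat n n" for a b :: real and M N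
    using that
    by (subst mult_four_block_mat[of _ 1 1 _ n _ n _ _ 1 _ n])
      (auto intro!: cong_four_block_mat eq_matI simp: scalar_prod_def)
  have blk_one: "?blk 1 (1\<^sub>m n) = 1\<^sub>m ?m" by (rule eq_matI) auto
  have blkc: "?blk a M \<in> carrier_mat ?m ?m" if "M \<in> carrier_mat n n" for a M
    using four_block_carrier_mat[of "mat 1 1 (\<lambda>_. a)" 1 1 M n n] that by simp
  define F where "F = ?blk 1 Q"
  have F: "F \<in> carrier_mat ?m ?m" using blkc[OF Q] by (simp add: F_def)
  have Ft: "transpose_mat F = ?blk 1 (transpose_mat Q)"
    unfolding F_def using Q by (intro eq_matI) auto
  have FF: "F * transpose_mat F = 1\<^sub>m ?m" "transpose_mat F * F = 1\<^sub>m ?m"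
    unfolding Ft unfolding F_def
    using blk_mult[of Q "transpose_mat Q" 1 1] blk_mult[of "transpose_mat Q" Q 1 1] Q QQ blk_one by auto
  \<comment> \<open>\<open>case_nat e d\<close> puts \<open>e\<close> in front of the eigenvalues
    \<open>d\<close> of the smaller block.\<close>
  define D where "D = mat_diag ?m (case_nat e d)"
  have D: "D \<in> carrier_mat ?m ?m" by (simp add: D_def)
  have Dblk: "D = ?blk e (mat_diag n d)"
    by (rule eq_matI) (auto simp: D_def mat_diag_def split: nat.split)
  have "B = ?blk e B'"
    by (rule eq_matI) (use B in \<open>auto simp: B'_def col0 row0\<close>)
  also have "\<dots> = F * D * transpose_mat F"
    unfolding Ft Dblk unfolding F_def B'Q
    using blk_mult[of Q "mat_diag n d" 1 e] blk_mult[of "Q * mat_diag n d" "transpose_mat Q" e 1] Q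
    by auto
  finally have BF: "B = F * D * transpose_mat F" .
  note assoc = assoc_mult_mat[of _ ?m ?m _ ?m _ ?m]
  have cancel: "X * (Y * Z) = Z" if "X * Y = 1\<^sub>m ?m" "X \<in> carrier_mat ?m ?m" "Y \<in> carrier_mat ?m ?m"
    "Z \<in> carrier_mat ?m ?m" for X Y Z :: "real mat"
    using that by (metis assoc_mult_mat left_mult_one_mat)
  have "H * B * H = A"
    unfolding B_def using H A HH by (simp add: assoc cancel)
  hence AF: "A = (H * F) * D * transpose_mat (H * F)"
    unfolding BF using H F D Hs by (simp add: transpose_mult[of _ ?m ?m _ ?m] assoc)
  have 1: "(H * F) * transpose_mat (H * F) = 1\<^sub>m ?m"
    using H F Hs HH FF by (simp add: transpose_mult[of _ ?m ?m _ ?m] assoc cancel)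
  have 2: "transpose_mat (H * F) * (H * F) = 1\<^sub>m ?m"
    using H F Hs HH FF by (simp add: transpose_mult[of _ ?m ?m _ ?m] assoc cancel)
  show ?case
    using AF 1 2 H F unfolding D_def by (intro exI[of _ "H * F"] exI[of _ "case_nat e d"]) auto
qed

section \<open>Inertia read off from an orthonormal eigenbasis\<close>

lemma eigenvalue_mset_similar_diag:
  assumes "similar_mat A (mat_diag n d)"
  shows "eigenvalue_mset A = image_mset d (mset_set {..<n})"
proof -
  have "char_poly A = char_poly (mat_diag n d)" by (rule char_poly_similar[OF assms])
  also have "\<dots> = (\<Prod>a\<leftarrow>diag_mat (mat_diag n d). [:- a, 1:])"
    by (rule char_poly_upper_triangular[of _ n]) (auto simp: mat_diag_def)
  also have "diag_mat (mat_diag n d) = map d [0..<n]"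
    by (auto simp: diag_mat_def mat_diag_def)
  also have "(\<Prod>a\<leftarrow>map d [0..<n]. [:- a, 1:]) = (\<Prod>i<n. [:- d i, 1:])"
    using prod.distinct_set_conv_list[of "[0..<n]" "\<lambda>i. [:- d i, 1:]"]
    by (simp add: comp_def atLeast0LessThan)
  finally show ?thesis
    unfolding eigenvalue_mset_def
    by (simp only:, subst proots_prod[of "{..<n}" "\<lambda>i. [:- d i, 1:]"]) (simp_all add: sum_unfold_sum_mset)
qed

text \<open>The spectral decomposition in terms of sums, free of matrix products: \<open>p i\<close>
  is the eigenvector for \<open>d i\<close> and \<open>p i k\<close> its coordinate
  \<open>k\<close>. Thus \<open>orthonormal_rows\<close> is orthonormality of the eigenvectors, and
  \<open>orthonormal_columns\<close> is their completeness.\<close>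

locale orthonormal_eigenbasis =
  fixes n :: nat and A :: "real mat" and p :: "nat \<Rightarrow> nat \<Rightarrow> real" and d :: "nat \<Rightarrow> real"
  assumes orthonormal_columns:
      "\<And>i j. i < n \<Longrightarrow> j < n \<Longrightarrow> (\<Sum>k<n. p k i * p k j) = (if i = j then 1 else 0)"
    and orthonormal_rows:
      "\<And>i j. i < n \<Longrightarrow> j < n \<Longrightarrow> (\<Sum>k<n. p i k * p j k) = (if i = j then 1 else 0)"
    and entries: "\<And>j k. j < n \<Longrightarrow> k < n \<Longrightarrow> A $$ (j,k) = (\<Sum>i<n. d i * p i j * p i k)"
    and inertia_eq: "inertia A =
      (card {i. i < n \<and> d i > 0}, card {i. i < n \<and> d i < 0}, card {i. i < n \<and> d i = 0})"

lemma symmetric_mat_eigenbasis: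
  fixes A :: "real mat"
  assumes A: "A \<in> carrier_mat n n" and sym: "transpose_mat A = A"
  obtains p d where "orthonormal_eigenbasis n A p d"
proof -
  obtain P d where P: "P \<in> carrier_mat n n" and PP: "P * transpose_mat P = 1\<^sub>m n"
    "transpose_mat P * P = 1\<^sub>m n" and AP: "A = P * mat_diag n d * transpose_mat P"
    using real_symmetric_diagonalization[OF assms] by auto
  \<comment> \<open>The eigenvectors are the columns of \<open>P\<close>, hence the exchanged
    indices.\<close>
  show ?thesis
  proof (rule that[of "\<lambda>i j. P $$ (j,i)" d], unfold_locales)
    fix i j assume ij: "i < n" "j < n"
    show "(\<Sum>k<n. P $$ (i,k) * P $$ (j,k)) = (if i = j then 1 else 0)"
      using arg_cong[OF PP(1), of "\<lambda>M. M $$ (i,j)"] ij P by (simp add: scalar_prod_def atLeast0LessThan)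
    show "(\<Sum>k<n. P $$ (k,i) * P $$ (k,j)) = (if i = j then 1 else 0)"
      using arg_cong[OF PP(2), of "\<lambda>M. M $$ (i,j)"] ij P by (simp add: scalar_prod_def atLeast0LessThan)
    show "A $$ (i,j) = (\<Sum>k<n. d k * P $$ (i,k) * P $$ (j,k))"
      using arg_cong[OF AP, of "\<lambda>M. M $$ (i,j)"] ij P
      by (simp add: scalar_prod_def atLeast0LessThan mat_diag_mult_right ac_simps)
  next
    have "similar_mat A (mat_diag n d)"
      by (rule similar_matI[of _ _ P "transpose_mat P" n]) (use A P PP AP in auto)
    note ev = eigenvalue_mset_similar_diag[OF this]
    have "size {#x \<in># eigenvalue_mset A. Q x#} = card {i. i < n \<and> Q (d i)}" for Q
    proof -
      have "{i \<in> {..<n}. Q (d i)} = {i. i < n \<and> Q (d i)}" by auto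
      thus ?thesis unfolding ev by (simp add: filter_mset_image_mset)
    qed
    thus "inertia A =
      (card {i. i < n \<and> d i > 0}, card {i. i < n \<and> d i < 0}, card {i. i < n \<and> d i = 0})"
      unfolding inertia_def by simp
  qed
qed

text \<open>\<open>eigenvalue_mset\<close> collects real roots only; symmetry guarantees that none
  of the \<open>n\<close> eigenvalues is missed.\<close>

lemma inertia_sum:
  assumes "A \<in> carrier_mat n n" "transpose_mat A = A" "inertia A = (a, b, c)"
  shows "a + b + c = n"
proof -
  obtain p d where "orthonormal_eigenbasis n A p d"
    using symmetric_mat_eigenbasis[OF assms(1,2)] .
  then interpret orthonormal_eigenbasis n A p d .
  have "a + b + c = card {i. i < n \<and> d i > 0} + card {i. i < n \<and> d i < 0} + card {i. i < n \<and> d i = 0}"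
    using assms(3) inertia_eq by simp
  also have "\<dots> = card ({i. i < n \<and> d i > 0} \<union> {i. i < n \<and> d i < 0}) + card {i. i < n \<and> d i = 0}"
    by (subst card_Un_disjoint) auto
  also have "\<dots> = card ({i. i < n \<and> d i > 0} \<union> {i. i < n \<and> d i < 0} \<union> {i. i < n \<and> d i = 0})"
    by (subst card_Un_disjoint[of "_ \<union> _"]) auto
  also have "{i. i < n \<and> d i > 0} \<union> {i. i < n \<and> d i < 0} \<union> {i. i < n \<and> d i = 0} = {..<n}" by auto
  finally show ?thesis by simp
qed

text \<open>\<open>A\<close> multiplies the coefficient of \<open>x\<close> along \<open>p i\<close>
  by \<open>d i\<close>, so a kernel vector has coefficients only where
  \<open>d i = 0\<close>.\<close>

lemma (in orthonormal_eigenbasis) kernel_vector_expansion: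
  assumes ker: "\<And>j. j < n \<Longrightarrow> (\<Sum>k<n. A $$ (j,k) * x k) = 0" and j: "j < n"
  shows "x j = (\<Sum>i | i < n \<and> d i = 0. p i j * (\<Sum>k<n. p i k * x k))"
proof -
  define y where "y i = (\<Sum>k<n. p i k * x k)" for i
  have Ax: "(\<Sum>k<n. A $$ (j,k) * x k) = (\<Sum>l<n. d l * p l j * y l)" if "j < n" for j
  proof -
    have "(\<Sum>k<n. A $$ (j,k) * x k) = (\<Sum>k<n. \<Sum>l<n. d l * p l j * p l k * x k)"
      using that by (simp add: entries sum_distrib_right)
    also have "\<dots> = (\<Sum>l<n. \<Sum>k<n. d l * p l j * p l k * x k)" by (rule sum.swap)
    finally show ?thesis by (simp add: y_def sum_distrib_left mult.assoc)
  qed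
  \<comment> \<open>The inner product of the zero vector \<open>A x\<close> with \<open>p i\<close>
    isolates \<open>d i * y i\<close> by orthonormality.\<close>
  have dy: "d i * y i = 0" if i: "i < n" for i
  proof -
    have "0 = (\<Sum>j<n. p i j * (\<Sum>l<n. d l * p l j * y l))"
      by (rule sum.neutral[symmetric]) (use Ax ker in auto)
    also have "\<dots> = (\<Sum>j<n. \<Sum>l<n. d l * y l * (p i j * p l j))"
      by (simp add: sum_distrib_left ac_simps)
    also have "\<dots> = (\<Sum>l<n. \<Sum>j<n. d l * y l * (p i j * p l j))" by (rule sum.swap)
    also have "\<dots> = (\<Sum>l<n. d l * y l * (if i = l then 1 else 0))"
      using i by (simp add: sum_distrib_left[symmetric] orthonormal_rows)
    also have "\<dots> = d i * y i" using i by (simp add: sum.delta if_distrib cong: if_cong)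
    finally show ?thesis by simp
  qed
  \<comment> \<open>The terms with \<open>d i \<noteq> 0\<close> vanish by \<open>dy\<close>, so the
    sum extends to the full expansion of \<open>x\<close>.\<close>
  have "(\<Sum>i | i < n \<and> d i = 0. p i j * y i) = (\<Sum>i<n. p i j * y i)"
    by (rule sum.mono_neutral_left) (use dy in auto)
  also have "\<dots> = (\<Sum>i<n. \<Sum>k<n. x k * (p i j * p i k))"
    by (simp add: y_def sum_distrib_left ac_simps)
  also have "\<dots> = (\<Sum>k<n. \<Sum>i<n. x k * (p i j * p i k))" by (rule sum.swap)
  also have "\<dots> = (\<Sum>k<n. x k * (if j = k then 1 else 0))"
    using j by (simp add: sum_distrib_left[symmetric] orthonormal_columns)
  also have "\<dots> = x j" using j by (simp add: sum.delta if_distrib cong: if_cong)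
  finally show ?thesis by (simp add: y_def)
qed

lemma inertia_nullity_ge_1:
  fixes A :: "real mat"
  assumes A: "A \<in> carrier_mat n n" "transpose_mat A = A" "inertia A = (a, b, c)"
    and x: "\<And>j. j < n \<Longrightarrow> (\<Sum>k<n. A $$ (j,k) * x k) = 0" and i: "i < n" "x i \<noteq> 0"
  shows "c \<ge> 1"
proof -
  obtain p d where "orthonormal_eigenbasis n A p d"
    using symmetric_mat_eigenbasis[OF A(1,2)] .
  then interpret orthonormal_eigenbasis n A p d .
  have "{i. i < n \<and> d i = 0} \<noteq> {}"
  proof
    assume e: "{i. i < n \<and> d i = 0} = {}"
    show False using kernel_vector_expansion[OF x i(1)] i(2) unfolding e by simp
  qed
  hence "card {i. i < n \<and> d i = 0} > 0" by (simp add: card_gt_0_iff)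
  thus ?thesis using inertia_eq A(3) by simp
qed

text \<open>The conditions at \<open>i\<close> and \<open>j\<close> are an elementary certificate of
  linear independence. With only one zero eigenvalue, \<open>x\<close> and \<open>y\<close> would
  both be multiples of the same \<open>p l\<close>; then \<open>x i \<noteq> 0\<close> and
  \<open>y i = 0\<close> make \<open>y\<close> zero, against \<open>y j \<noteq> 0\<close>.\<close>

lemma inertia_nullity_ge_2:
  fixes A :: "real mat"
  assumes A: "A \<in> carrier_mat n n" "transpose_mat A = A" "inertia A = (a, b, c)"
    and x: "\<And>j. j < n \<Longrightarrow> (\<Sum>k<n. A $$ (j,k) * x k) = 0"
    and y: "\<And>j. j < n \<Longrightarrow> (\<Sum>k<n. A $$ (j,k) * y k) = 0"
    and i: "i < n" "x i \<noteq> 0" "y i = 0" and j: "j < n" "y j \<noteq> 0"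
  shows "c \<ge> 2"
proof (rule ccontr)
  assume "\<not> c \<ge> 2"
  with inertia_nullity_ge_1[OF A x i(1,2)] have c: "c = 1" by simp
  obtain p d where "orthonormal_eigenbasis n A p d"
    using symmetric_mat_eigenbasis[OF A(1,2)] .
  then interpret orthonormal_eigenbasis n A p d .
  have "card {i. i < n \<and> d i = 0} = 1" using inertia_eq A(3) c by simp
  then obtain l where l: "{i. i < n \<and> d i = 0} = {l}" by (rule card_1_singletonE)
  have ex: "x j = p l j * (\<Sum>k<n. p l k * x k)" if "j < n" for j
    using kernel_vector_expansion[OF x that] unfolding l by simp
  have ey: "y j = p l j * (\<Sum>k<n. p l k * y k)" if "j < n" for j
    using kernel_vector_expansion[OF y that] unfolding l by simp
  show False using ex[OF i(1)] ey[OF i(1)] ey[OF j(1)] i j by auto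
qed

text \<open>In eigenbasis coordinates the form is a sum of squares weighted by the
  \<open>d i\<close>, so a strict sign of its value requires some \<open>d i\<close> of that
  sign.\<close>

lemma inertia_quadratic_form:
  fixes A :: "real mat"
  assumes A: "A \<in> carrier_mat n n" "transpose_mat A = A" "inertia A = (a, b, c)"
  shows "(\<Sum>j<n. \<Sum>k<n. x j * A $$ (j,k) * x k) > 0 \<Longrightarrow> a \<ge> 1"
    and "(\<Sum>j<n. \<Sum>k<n. x j * A $$ (j,k) * x k) < 0 \<Longrightarrow> b \<ge> 1"
proof -
  obtain p d where "orthonormal_eigenbasis n A p d"
    using symmetric_mat_eigenbasis[OF A(1,2)] .
  then interpret orthonormal_eigenbasis n A p d .
  have "(\<Sum>j<n. \<Sum>k<n. x j * A $$ (j,k) * x k) =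
      (\<Sum>j<n. \<Sum>k<n. \<Sum>i<n. d i * ((p i j * x j) * (p i k * x k)))"
    by (simp add: entries sum_distrib_left sum_distrib_right ac_simps)
  also have "\<dots> = (\<Sum>j<n. \<Sum>i<n. \<Sum>k<n. d i * ((p i j * x j) * (p i k * x k)))"
    by (rule sum.cong[OF refl], rule sum.swap)
  also have "\<dots> = (\<Sum>i<n. \<Sum>j<n. \<Sum>k<n. d i * ((p i j * x j) * (p i k * x k)))"
    by (rule sum.swap)
  also have "\<dots> = (\<Sum>i<n. d i * (\<Sum>j<n. p i j * x j)\<^sup>2)"
    by (simp add: sum_distrib_left[symmetric] sum_distrib_right[symmetric] power2_eq_square)
  finally have Q: "(\<Sum>j<n. \<Sum>k<n. x j * A $$ (j,k) * x k) = (\<Sum>i<n. d i * (\<Sum>j<n. p i j * x j)\<^sup>2)" .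
  have cards: "a = card {i. i < n \<and> d i > 0}" "b = card {i. i < n \<and> d i < 0}"
    using inertia_eq A(3) by auto
  show "a \<ge> 1" if "(\<Sum>j<n. \<Sum>k<n. x j * A $$ (j,k) * x k) > 0"
  proof -
    have "\<exists>i<n. d i > 0"
    proof (rule ccontr)
      assume "\<not> (\<exists>i<n. d i > 0)"
      hence "(\<Sum>i<n. d i * (\<Sum>j<n. p i j * x j)\<^sup>2) \<le> 0"
        by (intro sum_nonpos mult_nonpos_nonneg) auto
      thus False using that unfolding Q by simp
    qed
    thus ?thesis unfolding cards by (auto simp: Suc_le_eq card_gt_0_iff)
  qed
  show "b \<ge> 1" if "(\<Sum>j<n. \<Sum>k<n. x j * A $$ (j,k) * x k) < 0"
  proof -
    have "\<exists>i<n. d i < 0"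
    proof (rule ccontr)
      assume "\<not> (\<exists>i<n. d i < 0)"
      hence "(\<Sum>i<n. d i * (\<Sum>j<n. p i j * x j)\<^sup>2) \<ge> 0"
        by (intro sum_nonneg mult_nonneg_nonneg) auto
      thus False using that unfolding Q by simp
    qed
    thus ?thesis unfolding cards by (auto simp: Suc_le_eq card_gt_0_iff)
  qed
qed

text \<open>At most \<open>a + b\<close> terms of the spectral decomposition survive; if one does,
  \<open>r\<close> is its eigenvalue and \<open>q\<close> its eigenvector.\<close>

lemma inertia_rank_le_1:
  fixes A :: "real mat"
  assumes A: "A \<in> carrier_mat n n" "transpose_mat A = A" "inertia A = (a, b, c)" and ab: "a + b \<le> 1"
  obtains r q where "\<And>j k. j < n \<Longrightarrow> k < n \<Longrightarrow> A $$ (j,k) = r * q j * q k"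
proof -
  obtain p d where "orthonormal_eigenbasis n A p d"
    using symmetric_mat_eigenbasis[OF A(1,2)] .
  then interpret orthonormal_eigenbasis n A p d .
  define N where "N = {i. i < n \<and> d i \<noteq> 0}"
  have fN: "finite N" by (simp add: N_def)
  have "N = {i. i < n \<and> d i > 0} \<union> {i. i < n \<and> d i < 0}" by (auto simp: N_def)
  hence "card N \<le> a + b" using inertia_eq A(3) card_Un_le by auto
  hence "card N = 0 \<or> card N = 1" using ab by linarith
  hence "N = {} \<or> (\<exists>l. N = {l})" using fN by (auto simp: card_1_singleton_iff)
  moreover have An: "A $$ (j,k) = (\<Sum>i\<in>N. d i * p i j * p i k)" if "j < n" "k < n" for j k
    unfolding entries[OF that] N_def by (rule sum.mono_neutral_right) auto
  ultimately show ?thesis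
  proof (elim disjE exE)
    assume N: "N = {}"
    show ?thesis by (rule that[of 0 "\<lambda>_. 0"]) (use An[unfolded N] in simp)
  next
    fix l assume N: "N = {l}"
    show ?thesis by (rule that[of "d l" "p l"]) (use An[unfolded N] in simp)
  qed
qed

section \<open>Entries, row sums and cuts of the Laplacian\<close>

lemma laplacian_carrier: "laplacian n E \<gamma> \<in> carrier_mat n n"
  by (rule carrier_matI) (simp_all add: laplacian_def adjacency_matrix_def degree_matrix_def mat_diag_def)

lemma laplacian_index:
  assumes "j < n" "k < n"
  shows "laplacian n E \<gamma> $$ (j,k) = (if {j,k} \<in> E then \<gamma> {j,k} else 0) -
    (if j = k then (\<Sum>e\<in>{e\<in>E. j \<in> e}. \<gamma> e) else 0)"
  using assms by (simp add: laplacian_def adjacency_matrix_def degree_matrix_def mat_diag_def)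

lemma laplacian_symmetric: "transpose_mat (laplacian n E \<gamma>) = laplacian n E \<gamma>"
  using laplacian_carrier[of n E \<gamma>]
  by (intro eq_matI) (auto simp: laplacian_index insert_commute)

text \<open>Mapping \<open>k\<close> to \<open>{j,k}\<close> is a bijection from the neighbours of
  \<open>j\<close> onto the edges at \<open>j\<close>, so the adjacency entries of row
  \<open>j\<close> sum to its degree. The diagonal contributes no adjacency entry, as edges have two
  elements.\<close>

lemma laplacian_row_sum:
  assumes "signed_graph n E s" and j: "j < n"
  shows "(\<Sum>k<n. laplacian n E \<gamma> $$ (j,k)) = 0"
proof -
  have E: "e \<subseteq> {..<n}" "card e = 2" if "e \<in> E" for e
    using assms that unfolding signed_graph_def by auto
  have "(\<Sum>k<n. if {j,k} \<in> E then \<gamma> {j,k} else 0) = (\<Sum>k\<in>{k. k < n \<and> {j,k} \<in> E}. \<gamma> {j,k})"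
    by (rule sum.mono_neutral_cong_right) auto
  also have "\<dots> = (\<Sum>e\<in>{e\<in>E. j \<in> e}. \<gamma> e)"
  proof (rule sum.reindex_bij_betw, rule bij_betw_imageI)
    show "inj_on (\<lambda>k. {j,k}) {k. k < n \<and> {j,k} \<in> E}" by (auto simp: inj_on_def doubleton_eq_iff)
    show "(\<lambda>k. {j,k}) ` {k. k < n \<and> {j,k} \<in> E} = {e\<in>E. j \<in> e}"
    proof (intro equalityI subsetI)
      fix e assume e: "e \<in> {e\<in>E. j \<in> e}"
      then obtain k where "e = {j,k}" using E(2)[of e] by (auto simp: card_2_iff)
      thus "e \<in> (\<lambda>k. {j,k}) ` {k. k < n \<and> {j,k} \<in> E}" using e E(1)[of e] by auto
    qed auto
  qed
  finally show ?thesis using j by (simp add: laplacian_index sum_subtractf)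
qed

text \<open>The form at the indicator of \<open>S\<close> sums the entries with both indices in
  \<open>S\<close>; since rows sum to zero, each row's part inside \<open>S\<close> is minus its
  part outside.\<close>

lemma cut_quadratic_form:
  fixes A :: "real mat"
  assumes row: "\<And>j. j < n \<Longrightarrow> (\<Sum>k<n. A $$ (j,k)) = 0" and S: "S \<subseteq> {..<n}"
  shows "(\<Sum>j<n. \<Sum>k<n. of_bool (j \<in> S) * A $$ (j,k) * of_bool (k \<in> S)) =
    - (\<Sum>(j,k)\<in>S \<times> ({..<n} - S). A $$ (j,k))"
proof -
  have fS: "finite S" using S finite_subset by blast
  have "(\<Sum>j<n. \<Sum>k<n. of_bool (j \<in> S) * A $$ (j,k) * of_bool (k \<in> S)) = (\<Sum>j\<in>S. \<Sum>k\<in>S. A $$ (j,k))"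
    using S by (intro sum.mono_neutral_cong_right) (auto intro!: sum.mono_neutral_cong_right)
  also have "\<dots> = (\<Sum>j\<in>S. - (\<Sum>k\<in>{..<n} - S. A $$ (j,k)))"
  proof (rule sum.cong[OF refl])
    fix j assume "j \<in> S"
    hence "(\<Sum>k<n. A $$ (j,k)) = 0" using row S by auto
    thus "(\<Sum>k\<in>S. A $$ (j,k)) = - (\<Sum>k\<in>{..<n} - S. A $$ (j,k))"
      using sum.subset_diff[of S "{..<n}" "\<lambda>k. A $$ (j,k)"] S by simp
  qed
  finally show ?thesis by (simp add: sum_negf sum.cartesian_product)
qed

section \<open>Constraints on the inertia from the signs of the edges across cuts\<close>

context
  fixes n :: nat and E s \<gamma> a b c
  assumes sg: "signed_graph n E s" and cw: "consistent_weighting E s \<gamma>"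
    and ine: "inertia (laplacian n E \<gamma>) = (a, b, c)"
begin

lemma laplacian_sign:
  assumes "j < n" "k < n" "j \<noteq> k"
  shows "laplacian n E \<gamma> $$ (j,k) > 0 \<longleftrightarrow> {j,k} \<in> E \<and> s {j,k} = Pos"
    and "laplacian n E \<gamma> $$ (j,k) < 0 \<longleftrightarrow> {j,k} \<in> E \<and> s {j,k} = Neg"
proof -
  have "if s {j,k} = Pos then \<gamma> {j,k} > 0 else \<gamma> {j,k} < 0" if "{j,k} \<in> E"
    using cw that unfolding consistent_weighting_def by (cases "s {j,k}") auto
  thus "laplacian n E \<gamma> $$ (j,k) > 0 \<longleftrightarrow> {j,k} \<in> E \<and> s {j,k} = Pos"
    and "laplacian n E \<gamma> $$ (j,k) < 0 \<longleftrightarrow> {j,k} \<in> E \<and> s {j,k} = Neg"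
    using assms by (cases "s {j,k}"; auto simp: laplacian_index split: if_splits)+
qed

lemma laplacian_cut_form:
  "S \<subseteq> {..<n} \<Longrightarrow>
    (\<Sum>j<n. \<Sum>k<n. of_bool (j \<in> S) * laplacian n E \<gamma> $$ (j,k) * of_bool (k \<in> S)) =
    - (\<Sum>(j,k)\<in>S \<times> ({..<n} - S). laplacian n E \<gamma> $$ (j,k))"
  by (rule cut_quadratic_form) (use laplacian_row_sum[OF sg] in auto)

lemma laplacian_inertia_sum: "a + b + c = n"
  by (rule inertia_sum[OF laplacian_carrier laplacian_symmetric ine])

lemma laplacian_nullity: "n > 0 \<Longrightarrow> c \<ge> 1"
  by (rule inertia_nullity_ge_1[OF laplacian_carrier laplacian_symmetric ine, of "\<lambda>_. 1" 0])
    (use laplacian_row_sum[OF sg] in auto)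

text \<open>The Laplacian is block diagonal with respect to \<open>S\<close> and its complement, so
  both indicator vectors lie in the kernel.\<close>

lemma no_crossing_edges_imp_nullity:
  assumes S: "S \<subseteq> {..<n}" "i \<in> S" "j \<in> {..<n} - S"
    and no: "\<And>j k. j \<in> S \<Longrightarrow> k \<in> {..<n} - S \<Longrightarrow> {j,k} \<notin> E"
  shows "c \<ge> 2"
proof -
  let ?L = "laplacian n E \<gamma>"
  have 0: "?L $$ (j,k) = 0" if "j < n" "k < n" "j \<in> S \<longleftrightarrow> k \<notin> S" for j k
    using that no[of j k] no[of k j] by (auto simp: laplacian_index insert_commute)
  have 1: "(\<Sum>k<n. ?L $$ (j,k) * of_bool (k \<in> S)) = 0" if j: "j < n" for j
  proof (cases "j \<in> S")
    case True
    hence "(\<Sum>k<n. ?L $$ (j,k) * of_bool (k \<in> S)) = (\<Sum>k<n. ?L $$ (j,k))"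
      using 0 j by (intro sum.cong) auto
    thus ?thesis using laplacian_row_sum[OF sg j] by simp
  next
    case False
    thus ?thesis using 0 j by (intro sum.neutral) auto
  qed
  \<comment> \<open>The indicator of the complement is the all-ones vector minus that of
    \<open>S\<close>.\<close>
  have 2: "(\<Sum>k<n. ?L $$ (j,k) * of_bool (k \<notin> S)) = 0" if j: "j < n" for j
    using 1[OF j] laplacian_row_sum[OF sg j, of \<gamma>]
    by (simp add: of_bool_not_iff algebra_simps sum_subtractf)
  show ?thesis
    by (rule inertia_nullity_ge_2[OF laplacian_carrier laplacian_symmetric ine 1 2, of i j])
      (use S in auto)
qed

text \<open>The form at the indicator of \<open>S\<close> is minus the total weight across the cut;
  no crossing weight is positive, and the edge \<open>{i,j}\<close> makes the inequality
  strict.\<close>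

lemma negative_cut_imp_positive_index:
  assumes S: "S \<subseteq> {..<n}" "i \<in> S" "j \<in> {..<n} - S" "{i,j} \<in> E"
    and neg: "\<And>j k. j \<in> S \<Longrightarrow> k \<in> {..<n} - S \<Longrightarrow> {j,k} \<in> E \<Longrightarrow> s {j,k} = Neg"
  shows "a \<ge> 1"
proof (rule inertia_quadratic_form(1)[OF laplacian_carrier laplacian_symmetric ine])
  let ?L = "laplacian n E \<gamma>"
  have fS: "finite (S \<times> ({..<n} - S))" using S(1) finite_subset by auto
  have le: "?L $$ (j,k) \<le> 0" if "j \<in> S" "k \<in> {..<n} - S" for j k
  proof -
    have "\<not> ?L $$ (j,k) > 0"
      by (subst laplacian_sign(1)) (use neg[OF that] that S(1) in auto)
    thus ?thesis by simp
  qed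
  have "?L $$ (i,j) < 0"
    by (subst laplacian_sign(2)) (use neg[OF S(2,3,4)] S in auto)
  hence "(\<Sum>(j,k)\<in>S \<times> ({..<n} - S). - ?L $$ (j,k)) > 0"
    by (intro sum_pos2[OF fS, of "(i,j)"]) (use le S in auto)
  thus "(\<Sum>j<n. \<Sum>k<n. of_bool (j \<in> S) * ?L $$ (j,k) * of_bool (k \<in> S)) > 0"
    unfolding laplacian_cut_form[OF S(1)]
    by (simp add: sum_negf case_prod_unfold)
qed

text \<open>The same evaluation with all signs reversed.\<close>

lemma positive_cut_imp_negative_index:
  assumes S: "S \<subseteq> {..<n}" "i \<in> S" "j \<in> {..<n} - S" "{i,j} \<in> E"
    and pos: "\<And>j k. j \<in> S \<Longrightarrow> k \<in> {..<n} - S \<Longrightarrow> {j,k} \<in> E \<Longrightarrow> s {j,k} = Pos"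
  shows "b \<ge> 1"
proof (rule inertia_quadratic_form(2)[OF laplacian_carrier laplacian_symmetric ine])
  let ?L = "laplacian n E \<gamma>"
  have fS: "finite (S \<times> ({..<n} - S))" using S(1) finite_subset by auto
  have ge: "?L $$ (j,k) \<ge> 0" if "j \<in> S" "k \<in> {..<n} - S" for j k
  proof -
    have "\<not> ?L $$ (j,k) < 0"
      by (subst laplacian_sign(2)) (use pos[OF that] that S(1) in auto)
    thus ?thesis by simp
  qed
  have "?L $$ (i,j) > 0"
    by (subst laplacian_sign(1)) (use pos[OF S(2,3,4)] S in auto)
  hence "(\<Sum>(j,k)\<in>S \<times> ({..<n} - S). ?L $$ (j,k)) > 0"
    by (intro sum_pos2[OF fS, of "(i,j)"]) (use ge S in auto)
  thus "(\<Sum>j<n. \<Sum>k<n. of_bool (j \<in> S) * ?L $$ (j,k) * of_bool (k \<in> S)) < 0"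
    unfolding laplacian_cut_form[OF S(1)] by simp
qed

text \<open>If the Laplacian were \<open>r\<close> times q q^T, its entries between
  \<open>{k. q k > 0}\<close> and the complement could never have the sign of \<open>r\<close>,
  although this cut has edges of both signs.\<close>

lemma mixed_cuts_imp_rank_ge_2:
  assumes n: "n \<ge> 2"
    and mixed: "\<And>S \<sigma>. S \<subseteq> {..<n} \<Longrightarrow> S \<noteq> {} \<Longrightarrow> S \<noteq> {..<n} \<Longrightarrow>
      \<exists>j\<in>S. \<exists>k\<in>{..<n} - S. {j,k} \<in> E \<and> s {j,k} = \<sigma>"
  shows "a + b \<ge> 2"
proof (rule ccontr)
  let ?L = "laplacian n E \<gamma>"
  assume "\<not> a + b \<ge> 2"
  hence "a + b \<le> 1" by simp
  from inertia_rank_le_1[OF laplacian_carrier laplacian_symmetric ine this] obtain r q where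
    L: "\<And>j k. j < n \<Longrightarrow> k < n \<Longrightarrow> ?L $$ (j,k) = r * q j * q k" by metis
  \<comment> \<open>Only the sign of the real number \<open>\<sigma>\<close> matters; this form can
    be applied with \<open>\<sigma> = r\<close>, whose sign is unknown.\<close>
  have mixed_L: "\<exists>j\<in>S. \<exists>k\<in>{..<n} - S. \<sigma> * ?L $$ (j,k) > 0"
    if S: "S \<subseteq> {..<n}" "S \<noteq> {}" "S \<noteq> {..<n}" and "\<sigma> \<noteq> 0" for S and \<sigma> :: real
  proof -
    obtain j k where jk: "j \<in> S" "k \<in> {..<n} - S" "{j,k} \<in> E" "s {j,k} = (if \<sigma> > 0 then Pos else Neg)"
      using mixed[OF S, of "if \<sigma> > 0 then Pos else Neg"] by blast
    have "\<sigma> * ?L $$ (j,k) > 0"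
      using laplacian_sign[of j k] jk S(1) \<open>\<sigma> \<noteq> 0\<close>
      by (auto simp: zero_less_mult_iff split: if_splits)
    thus ?thesis using jk by blast
  qed
  \<comment> \<open>A positive edge at vertex 0 shows that \<open>r\<close> and \<open>q 0\<close>
    are nonzero; the zero sum of row 0 then forces the sum of \<open>q\<close> to vanish.\<close>
  have "1 \<in> {..<n} - {0}" using n by simp
  hence "{0} \<noteq> {..<n}" by blast
  moreover have "{0} \<subseteq> {..<n}" using n by simp
  ultimately have "\<exists>j\<in>{0}. \<exists>k\<in>{..<n} - {0}. 1 * ?L $$ (j,k) > 0" by (intro mixed_L) simp_all
  then obtain k where k: "k < n" "?L $$ (0,k) > 0" by auto
  hence r: "r \<noteq> 0" and q0: "q 0 \<noteq> 0" using L[of 0 k] n by auto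
  have "r * q 0 * (\<Sum>k<n. q k) = (\<Sum>k<n. ?L $$ (0,k))"
    using n by (simp add: L sum_distrib_left)
  hence sum0: "(\<Sum>k<n. q k) = 0" using laplacian_row_sum[OF sg, of 0 \<gamma>] n r q0 by auto
  \<comment> \<open>\<open>q\<close> is not zero but sums to zero, so it has a positive entry and
    not all of its entries are positive.\<close>
  define S where "S = {k. k < n \<and> q k > 0}"
  have "S \<noteq> {}"
  proof
    assume "S = {}"
    hence "\<forall>k<n. - q k \<ge> 0" by (force simp: S_def)
    moreover have "(\<Sum>k<n. - q k) = 0" using sum0 by (simp add: sum_negf)
    ultimately show False using sum_nonneg_eq_0_iff[of "{..<n}" "\<lambda>k. - q k"] q0 n by auto
  qed
  moreover have "S \<noteq> {..<n}"
  proof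
    assume "S = {..<n}"
    hence "\<forall>k<n. q k > 0" by (auto simp: S_def)
    hence "(\<Sum>k<n. q k) > 0" using n by (intro sum_pos) (auto simp: lessThan_empty_iff)
    thus False using sum0 by simp
  qed
  moreover have "S \<subseteq> {..<n}" by (auto simp: S_def)
  ultimately obtain j k where jk: "j \<in> S" "k \<in> {..<n} - S" "r * ?L $$ (j,k) > 0"
    using mixed_L[of S r] r by blast
  hence "r * ?L $$ (j,k) = (r * r) * (q j * q k)" using L by (auto simp: S_def mult.assoc)
  moreover have "(r * r) * (q j * q k) \<le> 0"
    using jk by (intro mult_nonneg_nonpos) (auto simp: S_def mult_nonneg_nonpos)
  ultimately show False using jk(3) by linarith
qed

end

section \<open>Counting inertias as points of the triangle\<close>

lemma card_triangle: "card {(a::nat, b::nat). a + b < n} = (n + 1) choose 2"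
proof (induction n)
  case (Suc n)
  \<comment> \<open>Passing from \<open>n\<close> to \<open>Suc n\<close> adds the diagonal
    \<open>a + b = n\<close> with its \<open>n + 1\<close> points.\<close>
  have "{(a::nat, b::nat). a + b < Suc n} = {(a, b). a + b < n} \<union> (\<lambda>a. (a, n - a)) ` {..n}" by force
  moreover have "finite {(a::nat, b::nat). a + b < n}"
    by (rule finite_subset[of _ "{..<n} \<times> {..<n}"]) auto
  ultimately have "card {(a::nat, b::nat). a + b < Suc n} =
      card {(a::nat, b::nat). a + b < n} + card ((\<lambda>a. (a, n - a)) ` {..n})"
    by (simp only:, subst card_Un_disjoint) auto
  also have "card ((\<lambda>a. (a, n - a)) ` {..n}) = Suc n"
    by (subst card_image) (auto simp: inj_on_def)
  finally show ?case using Suc by (simp add: numeral_2_eq_2)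
qed simp

text \<open>The entry \<open>c = n - a - b\<close> is determined by \<open>(a, b)\<close>, and
  \<open>c \<ge> 1\<close> puts this pair into the triangle. \<open>R\<close> holds the three
  excluded points.\<close>

lemma card_inertias_le:
  fixes X :: "(nat \<times> nat \<times> nat) set"
  assumes X: "\<And>a b c. (a, b, c) \<in> X \<Longrightarrow> a + b + c = n \<and> c \<ge> 1 \<and> (a, b) \<notin> R"
    and R: "R \<subseteq> {(a, b). a + b < n}" "card R = 3"
  shows "finite X \<and> card X \<le> ((n + 1) choose 2) - 3"
proof -
  let ?T = "{(a::nat, b::nat). a + b < n}"
  have fT: "finite ?T" by (rule finite_subset[of _ "{..<n} \<times> {..<n}"]) auto
  have sub: "X \<subseteq> (\<lambda>(a, b). (a, b, n - a - b)) ` (?T - R)"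
  proof
    fix t assume t: "t \<in> X"
    obtain a b c where abc: "t = (a, b, c)" by (cases t)
    from X[OF t[unfolded abc]] show "t \<in> (\<lambda>(a, b). (a, b, n - a - b)) ` (?T - R)"
      unfolding abc by (intro image_eqI[of _ _ "(a, b)"]) auto
  qed
  have "card X \<le> card ((\<lambda>(a, b). (a, b, n - a - b)) ` (?T - R))"
    by (rule card_mono[OF _ sub]) (use fT in auto)
  also have "\<dots> \<le> card (?T - R)" by (rule card_image_le) (use fT in auto)
  also have "\<dots> = card ?T - card R"
    by (rule card_Diff_subset) (use R fT finite_subset in auto)
  finally show ?thesis
    using finite_subset[OF sub] fT R(2) card_triangle[of n] by auto
qed

theorem theorem3p13:
  fixes n :: nat and E :: "nat set set" and s :: "nat set \<Rightarrow> sign"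
  assumes "signed_graph n E s" and "n \<ge> 3"
  shows "finite (achieved_inertias n E s) \<and>
         card (achieved_inertias n E s) \<le> ((n + 1) choose 2) - 3"
proof -
  let ?X = "achieved_inertias n E s"
  note sg = assms(1) and n = assms(2)
  have weighting: "\<exists>\<gamma>. consistent_weighting E s \<gamma> \<and> inertia (laplacian n E \<gamma>) = (a, b, c)"
    if "(a, b, c) \<in> ?X" for a b c
    using that unfolding achieved_inertias_def by force
  have basic: "a + b + c = n \<and> c \<ge> 1" if "(a, b, c) \<in> ?X" for a b c
    using weighting[OF that] laplacian_inertia_sum[OF sg] laplacian_nullity[OF sg] n by fastforce
  define cut where "cut S \<longleftrightarrow> S \<subseteq> {..<n} \<and> S \<noteq> {} \<and> S \<noteq> {..<n}" for S
  define crossing where "crossing S \<sigma> \<longleftrightarrow> (\<exists>j\<in>S. \<exists>k\<in>{..<n} - S. {j,k} \<in> E \<and> s {j,k} = \<sigma>)" for S \<sigma>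
  consider (none) S where "cut S" "\<not> crossing S Pos" "\<not> crossing S Neg"
    | (negative) S where "cut S" "crossing S Neg" "\<not> crossing S Pos"
    | (positive) S where "cut S" "crossing S Pos" "\<not> crossing S Neg"
    | (mixed) "\<And>S \<sigma>. cut S \<Longrightarrow> crossing S \<sigma>"
    by (metis sign.exhaust)
  thus ?thesis
  proof cases
    case none
    obtain i j where ij: "S \<subseteq> {..<n}" "i \<in> S" "j \<in> {..<n} - S"
      using none(1) unfolding cut_def by blast
    have no: "{j,k} \<notin> E" if "j \<in> S" "k \<in> {..<n} - S" for j k
      using none(2,3) that unfolding crossing_def by (metis sign.exhaust)
    have "c \<ge> 2" if "(a, b, c) \<in> ?X" for a b c
      using weighting[OF that] no_crossing_edges_imp_nullity[OF sg _ _ ij no] by blast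
    \<comment> \<open>The whole diagonal \<open>a + b = n - 1\<close> is excluded. Three of its
      points suffice, and \<open>n \<ge> 3\<close> keeps the subtractions from truncating.\<close>
    with basic show ?thesis
      by (intro card_inertias_le[where R = "{(0, n - 1), (1, n - 2), (2, n - 3)}"])
        (use n in force)+
  next
    case negative
    obtain i j where ij: "S \<subseteq> {..<n}" "i \<in> S" "j \<in> {..<n} - S" "{i,j} \<in> E"
      using negative(1,2) unfolding cut_def crossing_def by blast
    have neg: "s {j,k} = Neg" if "j \<in> S" "k \<in> {..<n} - S" "{j,k} \<in> E" for j k
      using negative(3) that unfolding crossing_def by (metis sign.exhaust)
    have "a \<ge> 1" if "(a, b, c) \<in> ?X" for a b c
      using weighting[OF that] negative_cut_imp_positive_index[OF sg _ _ ij neg] by blast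
    \<comment> \<open>The points with \<open>a = 0\<close> are excluded; \<open>(0, 2)\<close> lies
      in the triangle because \<open>n \<ge> 3\<close>.\<close>
    with basic show ?thesis
      by (intro card_inertias_le[where R = "{(0, 0), (0, 1), (0, 2)}"]) (use n in force)+
  next
    case positive
    obtain i j where ij: "S \<subseteq> {..<n}" "i \<in> S" "j \<in> {..<n} - S" "{i,j} \<in> E"
      using positive(1,2) unfolding cut_def crossing_def by blast
    have pos: "s {j,k} = Pos" if "j \<in> S" "k \<in> {..<n} - S" "{j,k} \<in> E" for j k
      using positive(3) that unfolding crossing_def by (metis sign.exhaust)
    have "b \<ge> 1" if "(a, b, c) \<in> ?X" for a b c
      using weighting[OF that] positive_cut_imp_negative_index[OF sg _ _ ij pos] by blast
    with basic show ?thesis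
      by (intro card_inertias_le[where R = "{(0, 0), (1, 0), (2, 0)}"]) (use n in force)+
  next
    case mixed
    have m: "\<exists>j\<in>S. \<exists>k\<in>{..<n} - S. {j,k} \<in> E \<and> s {j,k} = \<sigma>"
      if "S \<subseteq> {..<n}" "S \<noteq> {}" "S \<noteq> {..<n}" for S \<sigma>
      using mixed[of S \<sigma>] that unfolding cut_def crossing_def by blast
    have "a + b \<ge> 2" if "(a, b, c) \<in> ?X" for a b c
      using weighting[OF that] mixed_cuts_imp_rank_ge_2[OF sg _ _ _ m] n by auto
    \<comment> \<open>Exactly three points satisfy \<open>a + b \<le> 1\<close>.\<close>
    with basic show ?thesis
      by (intro card_inertias_le[where R = "{(0, 0), (1, 0), (0, 1)}"]) (use n in force)+
  qed
qed

end
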